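(* Let $(p_a^\alpha(x))$ be the associated graded sequence of a delta operator $f(D)$. Then for all integers $a\ne-1$ and all logarithmic indices $\alpha$, $$p_{a+1}^\alpha(x)=\sigma\,(f'(D))^{-1}p_a^\alpha(x),$$ where $\sigma$ is the standard Roman shift and $f'(D)$ is the Pincherle derivative of $f(D)$.
   Context: Setting (discrete case of the logarithmic umbral calculus). For $a\in\mathbb{Z}$ let $\lfloor a\rceil=a$ if $a\neq0$, $\lfloor 0\rceil=1$; $\lfloor a\rceil!=a!$ for $a\ge0$, $\lfloor a\rceil!=(-1)^{-a-1}/(-a-1)!$ for $a<0$. Harmonic logarithms $\lambda_a^\alpha(x)$ ($a\in\mathbb{Z}$, $\alpha$ a logarithmic index): $\lambda_a^{(0)}=x^a$ for $a\ge0$, $0$ for $a<0$; $\lambda_a^{(1)}=x^a(\log x-H_a)$ for $a\ge0$, $x^a$ for $a<0$; higher indices involve iterated logarithms. $\mathcal{I}^\alpha$: formal series $\sum_{b\le N}c_b\lambda_b^\alpha$. $D\lambda_a^\alpha=\lfloor a\rceil\lambda_{a-1}^\alpha$; Artinian operators $\sum_{a\ge k}c_aD^a$ (a field) act via $D^b\lambda_a^\alpha=\frac{\lfloor a\rceil!}{\lfloor a-b\rceil!}\lambda_{a-b}^\alpha$; delta operators are $\sum_{a\ge1}c_aD^a$ with $c_1\ne0$; the Pincherle derivative of $\sum c_aD^a$ is $\sum ac_aD^{a-1}$. $\langle\alpha\mid p\rangle$ = coefficient of $\lambda_0^\alpha$ in $p$. A graded sequence is a regular family $(p_a^\alpha)$,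 $p_a^\alpha\in\mathcal{I}^\alpha$ of degree $a$ (coefficients independent of $\alpha\ne(0)$; $p_a^{(0)}$ obtained from $p_a^{(1)}$ by $\lambda_b^{(1)}\mapsto\lambda_b^{(0)}$). The associated graded sequence of a delta operator $f(D)$ is the unique graded sequence with $\langle\alpha\mid p_0^\alpha\rangle=1$, $\langle\alpha\mid p_a^\alpha\rangle=0$ ($a\ne0$), $f(D)p_a^\alpha=\lfloor a\rceil p_{a-1}^\alpha$. The standard Roman shift $\sigma$ is the linear operator with $\sigma\lambda_a^\alpha=\lambda_{a+1}^\alpha$ for $a\ne-1$ and $\sigma\lambda_{-1}^\alpha=0$. *)

theory Defs
  imports
    "HOL-Library.Poly_Mapping"
    "HOL-Computational_Algebra.Formal_Laurent_Series"
begin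

section \<open>The iterated logarithmic algebra (discrete case)\<close>

text \<open>
  A logarithmic index is an integer sequence with finite support; its entry number \<open>i\<close> (counted
  from 0) is the exponent of the \<open>(i+1)\<close>-fold iterated logarithm \<open>L\<^sub>i\<close> of \<open>x\<close>. The indices
  written \<open>(0)\<close> and \<open>(1)\<close> are \<open>0\<close> and \<open>Poly_Mapping.single 0 1\<close>.
\<close>

type_synonym log_index = "nat \<Rightarrow>\<^sub>0 int"

text \<open>
  A formal series in \<open>x\<close> and the iterated logarithms is given by its coefficients: \<open>p a \<gamma>\<close> is the
  coefficient of \<open>x\<^sup>a \<Prod>\<^sub>i L\<^sub>i\<^sup>\<gamma>\<^sup>i\<close>.
\<close>

type_synonym 'k log_series = "int \<Rightarrow> log_index \<Rightarrow> 'k"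

definition log_scale :: "'k::field_char_0 \<Rightarrow> 'k log_series \<Rightarrow> 'k log_series" where
  "log_scale c p = (\<lambda>a \<gamma>. c * p a \<gamma>)"

definition log_monom :: "log_index \<Rightarrow> log_index \<Rightarrow> 'k::field_char_0" where
  "log_monom \<alpha> \<gamma> = (if \<gamma> = \<alpha> then 1 else 0)"

definition log_drop :: "nat \<Rightarrow> log_index" where
  "log_drop i = (\<Sum>j\<le>i. Poly_Mapping.single j 1)"

text \<open>
  The operator \<open>x d/dx\<close> on expressions in the logarithms alone: since
  \<open>x d/dx L\<^sub>i = 1 / (L\<^sub>0 \<cdots> L\<^sub>i\<^sub>-\<^sub>1)\<close>, it maps \<open>L\<^sup>\<beta>\<close> to the sum over \<open>i\<close> of
  \<open>\<beta>\<^sub>i L\<^sup>\<beta> / (L\<^sub>0 \<cdots> L\<^sub>i)\<close>.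
\<close>

definition log_euler :: "(log_index \<Rightarrow> 'k::field_char_0) \<Rightarrow> log_index \<Rightarrow> 'k" where
  "log_euler g \<gamma> =
     Sum_any (\<lambda>i. of_int (Poly_Mapping.lookup \<gamma> i + 1) * g (\<gamma> + log_drop i))"

definition log_deriv :: "'k::field_char_0 log_series \<Rightarrow> 'k log_series" where
  "log_deriv p a \<gamma> = of_int (a + 1) * p (a + 1) \<gamma> + log_euler (p (a + 1)) \<gamma>"

definition roman_num :: "int \<Rightarrow> 'k::field_char_0" where
  "roman_num a = (if a = 0 then 1 else of_int a)"

definition roman_fact :: "int \<Rightarrow> 'k::field_char_0" where
  "roman_fact a = (if a \<ge> 0 then fact (nat a) else (- 1) ^ nat (- a - 1) / fact (nat (- a - 1)))"


section \<open>Harmonic logarithms\<close>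

text \<open>
  \<open>\<lambda>\<^sub>0\<^sup>\<alpha>\<close> is \<open>L\<^sup>\<alpha>\<close>, and \<open>\<lambda>\<^sub>a\<^sup>\<alpha>\<close> is \<open>\<lfloor>a\<rceil>! D\<^sup>-\<^sup>a \<lambda>\<^sub>0\<^sup>\<alpha>\<close>, with antiderivatives free of constants of
  integration. On expressions \<open>x\<^sup>a u\<close>, with \<open>u\<close> in the logarithms alone, \<open>D\<close> is
  \<open>x\<^sup>-\<^sup>1 (a + \<theta>)\<close> with \<open>\<theta> = x d/dx\<close>. Hence \<open>\<lambda>\<^sub>a\<^sup>\<alpha> = x\<^sup>a S\<^sub>a(\<theta>) L\<^sup>\<alpha>\<close>, where the power series \<open>S\<^sub>a\<close> are
  determined by \<open>S\<^sub>0 = 1\<close> and \<open>(a + X) S\<^sub>a = \<lfloor>a\<rceil> S\<^sub>a\<^sub>-\<^sub>1\<close>. Each \<open>\<theta>\<close> lowers the exponent of \<open>log x\<close>,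
  so every coefficient receives only finitely many contributions. The lemmas
  \<open>log_deriv_harm_log\<close>, \<open>harm_log_zero\<close> and \<open>harm_log_one\<close> below confirm the characteristic
  properties.
\<close>

definition harm_gen :: "int \<Rightarrow> 'k::field_char_0 fps" where
  "harm_gen a =
     (if a \<ge> 0 then inverse (\<Prod>j=1..nat a. 1 + fps_const (1 / of_nat j) * fps_X)
      else fps_X * (\<Prod>j=1..<nat (- a). 1 - fps_const (1 / of_nat j) * fps_X))"

definition harm_log :: "log_index \<Rightarrow> int \<Rightarrow> 'k::field_char_0 log_series" where
  "harm_log \<alpha> a = (\<lambda>b \<gamma>. if b = a
     then Sum_any (\<lambda>k. fps_nth (harm_gen a) k * (log_euler ^^ k) (log_monom \<alpha>) \<gamma>) else 0)"

text \<open>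
  The formal sum of all \<open>c\<^sub>a \<lambda>\<^sub>a\<^sup>\<alpha>\<close>; for each monomial at most one summand contributes, namely the
  one whose degree is the exponent of \<open>x\<close>.
\<close>

definition harm_sum :: "log_index \<Rightarrow> (int \<Rightarrow> 'k::field_char_0) \<Rightarrow> 'k log_series" where
  "harm_sum \<alpha> c = (\<lambda>b \<gamma>. Sum_any (\<lambda>a. c a * harm_log \<alpha> a b \<gamma>))"

definition log_space :: "log_index \<Rightarrow> 'k::field_char_0 log_series set" where
  "log_space \<alpha> = {harm_sum \<alpha> c | c. \<exists>N. \<forall>b>N. c b = 0}"

text \<open>
  The coefficients of an element of \<open>log_space \<alpha>\<close>. As \<open>\<lambda>\<^sub>b\<^sup>\<alpha> = 0\<close> for \<open>\<alpha> = (0)\<close> and \<open>b < 0\<close>, the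
  meaningless coefficients there are normalised to 0; with this convention the coefficients are
  unique (\<open>harm_coeff_harm_sum\<close> below).
\<close>

definition harm_coeff :: "log_index \<Rightarrow> 'k::field_char_0 log_series \<Rightarrow> int \<Rightarrow> 'k" where
  "harm_coeff \<alpha> p = (THE c. p = harm_sum \<alpha> c \<and> (\<exists>N. \<forall>b>N. c b = 0) \<and>
     (\<alpha> = 0 \<longrightarrow> (\<forall>b<0. c b = 0)))"

text \<open>The augmentation \<open>\<langle>\<alpha> | p\<rangle>\<close>.\<close>

definition augmentation :: "log_index \<Rightarrow> 'k::field_char_0 log_series \<Rightarrow> 'k" where
  "augmentation \<alpha> p = harm_coeff \<alpha> p 0"


section \<open>Operators on the spaces of logarithmic series\<close>

text \<open>
  Artinian operators are the formal Laurent series in \<open>D\<close>, with composition as product; the Pincherle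
  derivative of \<open>f\<close> is \<open>fls_deriv f\<close>. The operator \<open>g(D)\<close> acts on the space with index \<open>\<alpha>\<close> by
  linear extension of \<open>D\<^sup>b \<lambda>\<^sub>a\<^sup>\<alpha> = \<lfloor>a\<rceil>! / \<lfloor>a-b\<rceil>! \<lambda>\<^sub>a\<^sub>-\<^sub>b\<^sup>\<alpha>\<close> to formal series; so the coefficient of
  \<open>\<lambda>\<^sub>n\<^sup>\<alpha>\<close> in the result collects the terms with \<open>a = n + b\<close>. For \<open>\<alpha> = (0)\<close> the rule is read for
  \<open>a \<ge> 0\<close>; negative powers of \<open>D\<close> are then only right inverses, whereas \<open>f\<close> and \<open>1 / f'\<close> for a
  delta operator \<open>f\<close> contain no negative powers.
\<close>

definition artinian_act ::
    "'k::field_char_0 fls \<Rightarrow> log_index \<Rightarrow> 'k log_series \<Rightarrow> 'k log_series" where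
  "artinian_act g \<alpha> p = harm_sum \<alpha> (\<lambda>n.
     Sum_any (\<lambda>b. fls_nth g b * harm_coeff \<alpha> p (n + b) * (roman_fact (n + b) / roman_fact n)))"

definition delta_operator :: "'k::field_char_0 fls \<Rightarrow> bool" where
  "delta_operator f \<longleftrightarrow> (\<forall>n<1. fls_nth f n = 0) \<and> fls_nth f 1 \<noteq> 0"

definition roman_shift :: "log_index \<Rightarrow> 'k::field_char_0 log_series \<Rightarrow> 'k log_series" where
  "roman_shift \<alpha> p = harm_sum \<alpha> (\<lambda>n. if n = 0 then 0 else harm_coeff \<alpha> p (n - 1))"


section \<open>Graded sequences\<close>

text \<open>
  The same coefficients serve all \<open>\<alpha> \<noteq> (0)\<close>, in particular \<open>(1)\<close>, and the member for \<open>(0)\<close> arises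
  from the one for \<open>(1)\<close> by replacing the harmonic logarithms. So one coefficient array serves
  all indices; for \<open>\<alpha> = (0)\<close> the terms with \<open>b < 0\<close> vanish because the harmonic logarithms do.
\<close>

definition graded_sequence :: "(int \<Rightarrow> log_index \<Rightarrow> 'k::field_char_0 log_series) \<Rightarrow> bool" where
  "graded_sequence p \<longleftrightarrow> (\<exists>c. \<forall>a. c a a \<noteq> 0 \<and> (\<forall>b>a. c a b = 0) \<and>
     (\<forall>\<alpha>. p a \<alpha> = harm_sum \<alpha> (c a)))"

definition associated_graded_sequence ::
    "'k::field_char_0 fls \<Rightarrow> (int \<Rightarrow> log_index \<Rightarrow> 'k log_series) \<Rightarrow> bool" where
  "associated_graded_sequence f p \<longleftrightarrow> graded_sequence p \<and>
     (\<forall>\<alpha>. augmentation \<alpha> (p 0 \<alpha>) = 1) \<and>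
     (\<forall>\<alpha> a. a \<noteq> 0 \<longrightarrow> augmentation \<alpha> (p a \<alpha>) = 0) \<and>
     (\<forall>\<alpha> a. artinian_act f \<alpha> (p a \<alpha>) = log_scale (roman_num a) (p (a - 1) \<alpha>))"

section \<open>Consistency with the characteristic properties\<close>

subsection \<open>Finiteness of the sums\<close>

definition log_bounded :: "int \<Rightarrow> nat \<Rightarrow> (log_index \<Rightarrow> 'k::field_char_0) \<Rightarrow> bool" where
  "log_bounded N m g \<longleftrightarrow> (\<forall>\<gamma>. g \<gamma> \<noteq> 0 \<longrightarrow>
     Poly_Mapping.lookup \<gamma> 0 \<le> N \<and> (\<forall>j>m. Poly_Mapping.lookup \<gamma> j = 0))"

lemma lookup_log_drop: "Poly_Mapping.lookup (log_drop i) j = (if j \<le> i then 1 else 0)"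
  by (auto simp: log_drop_def lookup_sum lookup_single when_def)

lemma log_drop_inject: "log_drop i = log_drop j \<longleftrightarrow> i = j"
proof
  assume "log_drop i = log_drop j"
  then have "\<And>k. k \<le> i \<longleftrightarrow> k \<le> j"
    by (metis lookup_log_drop zero_neq_one)
  then show "i = j" by (meson le_antisym order_refl)
qed simp

lemma log_euler_bounded_eq:
  assumes "log_bounded N m g"
  shows "log_euler g \<gamma> =
    (\<Sum>i\<le>m. of_int (Poly_Mapping.lookup \<gamma> i + 1) * g (\<gamma> + log_drop i))"
  unfolding log_euler_def
proof (rule Sum_any.expand_superset)
  show "{i. of_int (Poly_Mapping.lookup \<gamma> i + 1) * g (\<gamma> + log_drop i) \<noteq> 0} \<subseteq> {..m}"
  proof clarify
    fix i
    assume nz: "of_int (Poly_Mapping.lookup \<gamma> i + 1) * g (\<gamma> + log_drop i) \<noteq> 0"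
    show "i \<le> m"
    proof (rule ccontr)
      assume "\<not> i \<le> m"
      moreover have "g (\<gamma> + log_drop i) \<noteq> 0" using nz by auto
      ultimately have "Poly_Mapping.lookup (\<gamma> + log_drop i) i = 0"
        using assms unfolding log_bounded_def by auto
      then have "Poly_Mapping.lookup \<gamma> i + 1 = 0" by (simp add: lookup_add lookup_log_drop)
      then show False using nz by (metis mult_zero_left of_int_0)
    qed
  qed
qed simp

lemma log_bounded_euler:
  assumes "log_bounded N m g"
  shows "log_bounded (N - 1) m (log_euler g)"
  unfolding log_bounded_def
proof (intro allI impI)
  fix \<gamma>
  assume "log_euler g \<gamma> \<noteq> 0"
  then obtain i where i: "i \<le> m" "g (\<gamma> + log_drop i) \<noteq> 0"
    unfolding log_euler_bounded_eq[OF assms]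
    by (metis (no_types, lifting) atMost_iff mult_zero_right sum.not_neutral_contains_not_neutral)
  then have "Poly_Mapping.lookup (\<gamma> + log_drop i) 0 \<le> N"
    "\<forall>j>m. Poly_Mapping.lookup (\<gamma> + log_drop i) j = 0"
    using assms unfolding log_bounded_def by auto
  then show "Poly_Mapping.lookup \<gamma> 0 \<le> N - 1 \<and> (\<forall>j>m. Poly_Mapping.lookup \<gamma> j = 0)"
    using i(1) by (auto simp: lookup_add lookup_log_drop)
qed

lemma log_monom_bounded:
  obtains m where "log_bounded (Poly_Mapping.lookup \<alpha> 0) m (log_monom \<alpha>)"
proof -
  have "finite (Poly_Mapping.keys \<alpha>)" by simp
  then obtain m where "Poly_Mapping.keys \<alpha> \<subseteq> {..m}"
    by (meson finite_nat_iff_bounded_le)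
  then have "\<forall>j>m. Poly_Mapping.lookup \<alpha> j = 0"
    by (meson atMost_iff in_keys_iff leD subsetD)
  then have "log_bounded (Poly_Mapping.lookup \<alpha> 0) m (log_monom \<alpha>)"
    by (auto simp: log_bounded_def log_monom_def split: if_splits)
  then show ?thesis using that by blast
qed

lemma log_bounded_funpow:
  assumes "log_bounded N m g"
  shows "log_bounded (N - int k) m ((log_euler ^^ k) g)"
proof (induction k)
  case 0
  then show ?case using assms by simp
next
  case (Suc k)
  then show ?case using log_bounded_euler[OF Suc] by (simp add: algebra_simps)
qed

lemma log_euler_funpow_eq_0:
  assumes "Poly_Mapping.lookup \<alpha> 0 - Poly_Mapping.lookup \<gamma> 0 < int k"
  shows "(log_euler ^^ k) (log_monom \<alpha>) \<gamma> = 0"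
proof -
  obtain m where "log_bounded (Poly_Mapping.lookup \<alpha> 0) m (log_monom \<alpha> :: _ \<Rightarrow> 'a)"
    by (rule log_monom_bounded)
  from log_bounded_funpow[OF this, of k] show ?thesis
    using assms unfolding log_bounded_def by force
qed

lemma harm_log_eq_sum:
  assumes "Poly_Mapping.lookup \<alpha> 0 - Poly_Mapping.lookup \<gamma> 0 \<le> int K"
  shows "harm_log \<alpha> a a \<gamma> =
    (\<Sum>k\<le>K. fps_nth (harm_gen a) k * (log_euler ^^ k) (log_monom \<alpha>) \<gamma>)"
  unfolding harm_log_def if_P[OF refl]
proof (rule Sum_any.expand_superset)
  show "{k. fps_nth (harm_gen a) k * (log_euler ^^ k) (log_monom \<alpha>) \<gamma> \<noteq> 0} \<subseteq> {..K}"
  proof clarify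
    fix k
    assume "fps_nth (harm_gen a) k * (log_euler ^^ k) (log_monom \<alpha>) \<gamma> \<noteq> 0"
    then have "\<not> Poly_Mapping.lookup \<alpha> 0 - Poly_Mapping.lookup \<gamma> 0 < int k"
      using log_euler_funpow_eq_0 by fastforce
    then show "k \<le> K" using assms by linarith
  qed
qed simp

lemma harm_log_other: "b \<noteq> a \<Longrightarrow> harm_log \<alpha> a b = (\<lambda>\<gamma>. 0)"
  by (simp add: harm_log_def fun_eq_iff)

lemma log_euler_0: "log_euler (\<lambda>\<gamma>. 0) = (\<lambda>\<gamma>. 0)"
  by (simp add: log_euler_def fun_eq_iff)

lemma log_bounded_harm_log:
  assumes "log_bounded (Poly_Mapping.lookup \<alpha> 0) m (log_monom \<alpha> :: _ \<Rightarrow> 'k::field_char_0)"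
  shows "log_bounded (Poly_Mapping.lookup \<alpha> 0) m (harm_log \<alpha> a a :: _ \<Rightarrow> 'k)"
  unfolding log_bounded_def
proof (intro allI impI)
  fix \<gamma>
  assume nz: "(harm_log \<alpha> a a \<gamma> :: 'k) \<noteq> 0"
  define K where "K = nat (Poly_Mapping.lookup \<alpha> 0 - Poly_Mapping.lookup \<gamma> 0)"
  have "harm_log \<alpha> a a \<gamma> =
      (\<Sum>k\<le>K. fps_nth (harm_gen a) k * (log_euler ^^ k) (log_monom \<alpha>) \<gamma> :: 'k)"
    by (rule harm_log_eq_sum) (simp add: K_def)
  with nz obtain k where "((log_euler ^^ k) (log_monom \<alpha>) \<gamma> :: 'k) \<noteq> 0"
    by (metis (no_types, lifting) mult_zero_right sum.neutral)
  with log_bounded_funpow[OF assms, of k]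
  show "Poly_Mapping.lookup \<gamma> 0 \<le> Poly_Mapping.lookup \<alpha> 0 \<and> (\<forall>j>m. Poly_Mapping.lookup \<gamma> j = 0)"
    unfolding log_bounded_def by force
qed

lemma log_euler_harm_log:
  assumes "Poly_Mapping.lookup \<alpha> 0 - Poly_Mapping.lookup \<gamma> 0 \<le> int K"
  shows "log_euler (harm_log \<alpha> a a) \<gamma> =
    (\<Sum>k\<le>K. fps_nth (harm_gen a) k * (log_euler ^^ Suc k) (log_monom \<alpha>) \<gamma> :: 'k::field_char_0)"
proof -
  obtain m where m: "log_bounded (Poly_Mapping.lookup \<alpha> 0) m (log_monom \<alpha> :: _ \<Rightarrow> 'k)"
    by (rule log_monom_bounded)
  have *: "harm_log \<alpha> a a (\<gamma> + log_drop i) =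
      (\<Sum>k\<le>K. fps_nth (harm_gen a) k * (log_euler ^^ k) (log_monom \<alpha>) (\<gamma> + log_drop i) :: 'k)" for i
    using assms by (intro harm_log_eq_sum) (simp add: lookup_add lookup_log_drop)
  have "log_euler (harm_log \<alpha> a a) \<gamma> =
     (\<Sum>i\<le>m. of_int (Poly_Mapping.lookup \<gamma> i + 1) *
       (\<Sum>k\<le>K. fps_nth (harm_gen a) k * (log_euler ^^ k) (log_monom \<alpha>) (\<gamma> + log_drop i) :: 'k))"
    unfolding log_euler_bounded_eq[OF log_bounded_harm_log[OF m]] * ..
  also have "\<dots> = (\<Sum>k\<le>K. fps_nth (harm_gen a) k *
      (\<Sum>i\<le>m. of_int (Poly_Mapping.lookup \<gamma> i + 1) *
        (log_euler ^^ k) (log_monom \<alpha>) (\<gamma> + log_drop i)))"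
    unfolding sum_distrib_left by (subst sum.swap) (simp only: mult.left_commute)
  also have "\<dots> = (\<Sum>k\<le>K. fps_nth (harm_gen a) k * (log_euler ^^ Suc k) (log_monom \<alpha>) \<gamma>)"
    by (simp add: log_euler_bounded_eq[OF log_bounded_funpow[OF m]])
  finally show ?thesis .
qed


subsection \<open>The derivative of a harmonic logarithm\<close>

lemma harm_gen_rec:
  "(fps_const (of_int a) + fps_X) * harm_gen a = fps_const (roman_num a) * harm_gen (a - 1)"
proof -
  consider "a > 0" | "a = 0" | "a < 0" by linarith
  then show ?thesis
  proof cases
    case 1
    then obtain n where a: "a = int (Suc n)"
      by (metis gr0_implies_Suc zero_less_imp_eq_int)
    let ?P = "\<lambda>n. \<Prod>j=1..n. 1 + fps_const (1 / of_nat j) * fps_X :: 'a fps"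
    let ?f = "1 + fps_const (1 / of_nat (Suc n)) * fps_X :: 'a fps"
    have f: "fps_nth ?f 0 \<noteq> 0" by simp
    have P: "inverse (?P (Suc n)) = inverse (?P n) * inverse ?f"
      by (simp add: fps_inverse_mult)
    have "(of_nat (Suc n) :: 'a) \<noteq> 0" by (rule of_nat_neq_0)
    then have "fps_const (of_nat (Suc n)) * ?f = fps_const (of_nat (Suc n)) + fps_X"
      by (simp only: distrib_left mult_1_right mult.assoc[symmetric] fps_const_mult) simp
    then have "(fps_const (of_nat (Suc n)) + fps_X) * inverse (?P (Suc n)) =
       fps_const (of_nat (Suc n)) * inverse (?P n) * (inverse ?f * ?f)"
      unfolding P by (metis (no_types, lifting) mult.assoc mult.commute)
    then have "(fps_const (of_nat (Suc n)) + fps_X) * inverse (?P (Suc n)) =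
       fps_const (of_nat (Suc n)) * inverse (?P n)"
      unfolding inverse_mult_eq_1[OF f] by simp
    moreover have "nat (int (Suc n)) = Suc n" "int (Suc n) - 1 = int n" "nat (int n) = n"
      "(0 \<le> int (Suc n)) = True" "(0 \<le> int n) = True" "(int (Suc n) = 0) = False"
      "(of_int (int (Suc n)) :: 'a) = of_nat (Suc n)" by simp_all
    ultimately show ?thesis unfolding a harm_gen_def roman_num_def by (simp only: if_True if_False)
  next
    case 2
    then show ?thesis by (simp add: harm_gen_def roman_num_def)
  next
    case 3
    define n where "n = nat (- a) - 1"
    have n: "a = - int (Suc n)" using 3 by (simp add: n_def)
    let ?P = "\<lambda>n. \<Prod>j=1..<n. 1 - fps_const (1 / of_nat j) * fps_X :: 'a fps"
    have "(of_nat (Suc n) :: 'a) \<noteq> 0" by (rule of_nat_neq_0)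
    then have "fps_const (- of_nat (Suc n)) * fps_const (1 / of_nat (Suc n)) = (- 1 :: 'a fps)"
      by (simp only: fps_const_mult) (simp del: of_nat_Suc fps_const_neg add: fps_const_neg[symmetric])
    then have e: "fps_const (- of_nat (Suc n)) * (1 - fps_const (1 / of_nat (Suc n)) * fps_X)
        = fps_const (- of_nat (Suc n)) + (fps_X :: 'a fps)"
      by (metis (no_types, lifting) diff_minus_eq_add mult.assoc mult_1_right mult_minus1
          right_diff_distrib)
    have "?P (Suc (Suc n)) = ?P (Suc n) * (1 - fps_const (1 / of_nat (Suc n)) * fps_X)"
      by (rule prod.atLeastLessThan_Suc) simp
    moreover have "nat (- a) = Suc n" "nat (- (a - 1)) = Suc (Suc n)" "\<not> a \<ge> 0" "\<not> a - 1 \<ge> 0"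
      "a \<noteq> 0" "(of_int a :: 'a) = - of_nat (Suc n)"
      using n by auto
    ultimately show ?thesis
      unfolding harm_gen_def roman_num_def by (simp only: if_False e[symmetric] mult_ac)
  qed
qed

lemma harm_gen_rec_nth:
  "of_int a * fps_nth (harm_gen a) k + (if k = 0 then 0 else fps_nth (harm_gen a) (k - 1)) =
     roman_num a * fps_nth (harm_gen (a - 1)) k"
  using arg_cong[OF harm_gen_rec[of a], of "\<lambda>s. fps_nth s k"]
  by (simp add: distrib_right)

theorem log_deriv_harm_log:
  "log_deriv (harm_log \<alpha> a) = log_scale (roman_num a) (harm_log \<alpha> (a - 1) :: 'k::field_char_0 log_series)"
proof (intro ext)
  fix b \<gamma>
  show "log_deriv (harm_log \<alpha> a) b \<gamma> = (log_scale (roman_num a) (harm_log \<alpha> (a - 1)) b \<gamma> :: 'k)"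
  proof (cases "b = a - 1")
    case False
    then have "b + 1 \<noteq> a" by simp
    then show ?thesis
      using False by (simp add: log_deriv_def log_scale_def harm_log_other log_euler_0)
  next
    case True
    define K where "K = nat (Poly_Mapping.lookup \<alpha> 0 - Poly_Mapping.lookup \<gamma> 0)"
    have K: "Poly_Mapping.lookup \<alpha> 0 - Poly_Mapping.lookup \<gamma> 0 \<le> int K"
      "Poly_Mapping.lookup \<alpha> 0 - Poly_Mapping.lookup \<gamma> 0 \<le> int (Suc K)" by (simp_all add: K_def)
    let ?e = "\<lambda>k. (log_euler ^^ k) (log_monom \<alpha>) \<gamma> :: 'k"
    let ?s = "\<lambda>a k. fps_nth (harm_gen a) k :: 'k"
    have b: "b + 1 = a" using True by simp
    have "log_deriv (harm_log \<alpha> a) b \<gamma> =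
        of_int a * (\<Sum>k\<le>Suc K. ?s a k * ?e k) + (\<Sum>k\<le>K. ?s a k * ?e (Suc k))"
      unfolding log_deriv_def b harm_log_eq_sum[OF K(2)] log_euler_harm_log[OF K(1)] ..
    also have "(\<Sum>k\<le>K. ?s a k * ?e (Suc k)) =
        (\<Sum>k\<le>Suc K. (if k = 0 then 0 else ?s a (k - 1)) * ?e k)"
      by (subst sum.atMost_Suc_shift) simp
    also have "of_int a * (\<Sum>k\<le>Suc K. ?s a k * ?e k) + \<dots> =
        (\<Sum>k\<le>Suc K. (of_int a * ?s a k + (if k = 0 then 0 else ?s a (k - 1))) * ?e k)"
      unfolding sum_distrib_left sum.distrib[symmetric]
      by (intro sum.cong refl) (simp only: distrib_right mult.assoc)
    also have "\<dots> = roman_num a * (\<Sum>k\<le>Suc K. ?s (a - 1) k * ?e k)"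
      unfolding harm_gen_rec_nth sum_distrib_left mult.assoc ..
    also have "\<dots> = log_scale (roman_num a) (harm_log \<alpha> (a - 1)) b \<gamma>"
      unfolding log_scale_def True harm_log_eq_sum[OF K(2)] ..
    finally show ?thesis .
  qed
qed


subsection \<open>The harmonic logarithms with index (0) and (1)\<close>

lemma harm_gen_nth_0: "fps_nth (harm_gen a) 0 = (if a \<ge> 0 then 1 else 0)"
proof -
  have "fps_nth (\<Prod>j=1..n. 1 + fps_const (1 / of_nat j) * fps_X :: 'a fps) 0 = 1" for n
    by (induction n) (simp_all add: fps_mult_nth)
  then show ?thesis by (simp add: harm_gen_def)
qed

lemma harm_gen_nth_1:
  "fps_nth (harm_gen a) 1 = (if a \<ge> 0 then - (\<Sum>j=1..nat a. 1 / of_nat j) else 1)"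
proof (cases "a \<ge> 0")
  case True
  then obtain n where a: "a = int n" by (metis nonneg_int_cases)
  have "fps_nth (harm_gen (int n)) 1 = (- (\<Sum>j=1..n. 1 / of_nat j) :: 'a)"
  proof (induction n)
    case 0
    then show ?case by (simp add: harm_gen_def)
  next
    case (Suc n)
    have n: "(of_nat (Suc n) :: 'a) \<noteq> 0" by (rule of_nat_neq_0)
    have "of_nat (Suc n) * fps_nth (harm_gen (int (Suc n))) 1 + 1 =
        of_nat (Suc n) * (fps_nth (harm_gen (int n)) 1 :: 'a)"
      using harm_gen_rec_nth[of "int (Suc n)" 1, where 'a='a]
      by (simp add: harm_gen_nth_0 roman_num_def)
    then have "fps_nth (harm_gen (int (Suc n))) 1 =
        fps_nth (harm_gen (int n)) 1 - (1 / of_nat (Suc n) :: 'a)"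
      using n by (simp add: eq_diff_eq nonzero_divide_eq_eq[OF n] field_simps del: of_nat_Suc)
    then show ?case using Suc by simp
  qed
  then show ?thesis by (simp add: a)
next
  case False
  have "fps_nth (\<Prod>j=1..<n. 1 - fps_const (1 / of_nat j) * fps_X :: 'a fps) 0 = 1" for n
    by (induction n) (simp_all add: fps_mult_nth prod.atLeastLessThan_Suc atLeastLessThanSuc)
  then show ?thesis using False by (simp add: harm_gen_def)
qed

lemma log_euler_monom:
  "log_euler (log_monom \<alpha>) (\<alpha> - log_drop i) = of_int (Poly_Mapping.lookup \<alpha> i)"
proof -
  have "log_euler (log_monom \<alpha>) (\<alpha> - log_drop i) =
     Sum_any (\<lambda>j. if j = i then of_int (Poly_Mapping.lookup \<alpha> i) else 0)"
    unfolding log_euler_def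
  proof (rule Sum_any.cong)
    fix j
    have "\<alpha> - log_drop i + log_drop j = \<alpha> \<longleftrightarrow> j = i"
      by (metis add_diff_cancel_left' add_diff_cancel_right' diff_add_cancel log_drop_inject)
    then show "of_int (Poly_Mapping.lookup (\<alpha> - log_drop i) j + 1) *
        log_monom \<alpha> (\<alpha> - log_drop i + log_drop j) =
        (if j = i then of_int (Poly_Mapping.lookup \<alpha> i) else 0)"
      by (auto simp: log_monom_def lookup_minus lookup_log_drop)
  qed
  then show ?thesis by simp
qed

lemma log_euler_monom_other:
  assumes "\<And>i. \<gamma> \<noteq> \<alpha> - log_drop i"
  shows "log_euler (log_monom \<alpha>) \<gamma> = 0"
proof -
  have "\<gamma> + log_drop i \<noteq> \<alpha>" for i using assms[of i] by auto
  then show ?thesis by (simp add: log_euler_def log_monom_def)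
qed

lemma log_euler_monom_zero: "log_euler (log_monom 0) = (\<lambda>\<gamma>. 0)"
proof
  fix \<gamma>
  show "log_euler (log_monom 0) \<gamma> = 0"
  proof (cases "\<exists>i. \<gamma> = 0 - log_drop i")
    case True
    then obtain i where "\<gamma> = 0 - log_drop i" ..
    then show ?thesis using log_euler_monom[of 0 i] by simp
  next
    case False
    then show ?thesis by (intro log_euler_monom_other) blast
  qed
qed

lemma log_euler_funpow_zero: "(log_euler ^^ k) (\<lambda>\<gamma>. 0) = (\<lambda>\<gamma>. 0)"
  by (induction k) (simp_all add: log_euler_0)

lemma log_euler_monom_one:
  "log_euler (log_monom (Poly_Mapping.single 0 1)) = log_monom 0"
proof
  fix \<gamma>
  let ?one = "Poly_Mapping.single 0 1 :: log_index"
  have drop0: "log_drop 0 = ?one" by (simp add: log_drop_def)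
  show "log_euler (log_monom ?one) \<gamma> = log_monom 0 \<gamma>"
  proof (cases "\<exists>i. \<gamma> = ?one - log_drop i")
    case True
    then obtain i where i: "\<gamma> = ?one - log_drop i" ..
    have "\<gamma> = 0 \<longleftrightarrow> i = 0"
      unfolding i by (metis drop0 log_drop_inject right_minus_eq)
    then show ?thesis unfolding i log_euler_monom
      by (simp add: log_monom_def lookup_single when_def del: single_one)
  next
    case False
    then have "\<gamma> \<noteq> 0" by (metis drop0 diff_self)
    then show ?thesis using False
      by (subst log_euler_monom_other) (auto simp: log_monom_def)
  qed
qed

theorem harm_log_zero:
  "harm_log 0 a b \<gamma> = (if a \<ge> 0 \<and> b = a \<and> \<gamma> = 0 then 1 else 0)"
proof (cases "b = a")
  case True
  have "fps_nth (harm_gen a) k * (log_euler ^^ k) (log_monom 0) \<gamma> =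
     (if k = 0 then fps_nth (harm_gen a) 0 * log_monom 0 \<gamma> else 0 :: 'a)" for k
    by (cases k) (simp_all add: funpow_Suc_right log_euler_monom_zero log_euler_funpow_zero
        del: funpow.simps(2))
  then have "harm_log 0 a b \<gamma> = (fps_nth (harm_gen a) 0 * log_monom 0 \<gamma> :: 'a)"
    by (simp add: harm_log_def True)
  then show ?thesis by (simp add: harm_gen_nth_0 log_monom_def True)
qed (simp add: harm_log_other)

theorem harm_log_one:
  "harm_log (Poly_Mapping.single 0 1) a b \<gamma> =
     (if b \<noteq> a then 0
      else if \<gamma> = Poly_Mapping.single 0 1 then (if a \<ge> 0 then 1 else 0)
      else if \<gamma> = 0 then (if a \<ge> 0 then - (\<Sum>j=1..nat a. 1 / of_nat j) else 1)
      else 0)"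
proof (cases "b = a")
  case True
  let ?one = "Poly_Mapping.single 0 1 :: log_index"
  let ?t = "\<lambda>k. fps_nth (harm_gen a) k * (log_euler ^^ k) (log_monom ?one) \<gamma> :: 'a"
  have "?t (Suc (Suc k)) = 0" for k
    by (simp add: funpow_Suc_right log_euler_monom_one log_euler_monom_zero log_euler_funpow_zero
        del: funpow.simps(2) single_one)
  then have "?t k = 0" if "k \<notin> {0, 1}" for k
    using that by (cases k rule: nat.exhaust; cases "k - 1") auto
  then have "Sum_any ?t = sum ?t {0, 1}"
    by (intro Sum_any.expand_superset) auto
  also have "\<dots> = fps_nth (harm_gen a) 0 * log_monom ?one \<gamma> + fps_nth (harm_gen a) 1 * log_monom 0 \<gamma>"
    by (simp add: log_euler_monom_one del: single_one)
  finally have h: "harm_log ?one a b \<gamma> = (fps_nth (harm_gen a) 0 * log_monom ?one \<gamma> +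
      fps_nth (harm_gen a) 1 * log_monom 0 \<gamma> :: 'a)"
    by (simp add: harm_log_def True)
  have "?one \<noteq> 0" by simp
  then show ?thesis
    unfolding h harm_gen_nth_0 harm_gen_nth_1 by (auto simp: log_monom_def True)
qed (simp add: harm_log_other)


subsection \<open>Uniqueness of coefficients\<close>

lemma harm_log_nonzero:
  assumes "\<alpha> \<noteq> 0 \<or> a \<ge> 0"
  shows "\<exists>\<gamma>. (harm_log \<alpha> a a \<gamma> :: 'k::field_char_0) \<noteq> 0"
proof (cases "a \<ge> 0")
  case True
  have "harm_log \<alpha> a a \<alpha> =
      (\<Sum>k\<le>0. fps_nth (harm_gen a) k * (log_euler ^^ k) (log_monom \<alpha>) \<alpha> :: 'k)"
    by (rule harm_log_eq_sum) simp
  then have "harm_log \<alpha> a a \<alpha> = (1 :: 'k)"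
    using True by (simp add: harm_gen_nth_0 log_monom_def)
  then show ?thesis by (intro exI[of _ \<alpha>]) simp
next
  case False
  then have "\<alpha> \<noteq> 0" using assms by simp
  then obtain i where i: "Poly_Mapping.lookup \<alpha> i \<noteq> 0"
    by (metis lookup_zero poly_mapping_eqI)
  have "harm_log \<alpha> a a (\<alpha> - log_drop i) =
      (\<Sum>k\<le>1. fps_nth (harm_gen a) k * (log_euler ^^ k) (log_monom \<alpha>) (\<alpha> - log_drop i) :: 'k)"
    by (rule harm_log_eq_sum) (simp add: lookup_minus lookup_log_drop)
  then have "harm_log \<alpha> a a (\<alpha> - log_drop i) = (of_int (Poly_Mapping.lookup \<alpha> i) :: 'k)"
    using False harm_gen_nth_1[of a, where 'a='k]
    by (simp add: harm_gen_nth_0 log_euler_monom)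
  then show ?thesis using i by (intro exI[of _ "\<alpha> - log_drop i"]) simp
qed

lemma harm_sum_eq: "harm_sum \<alpha> c b \<gamma> = c b * harm_log \<alpha> b b \<gamma>"
proof -
  have "c a * harm_log \<alpha> a b \<gamma> = (if a = b then c b * harm_log \<alpha> b b \<gamma> else 0)" for a
    by (simp add: harm_log_other)
  then have "harm_sum \<alpha> c b \<gamma> = Sum_any (\<lambda>a. if a = b then c b * harm_log \<alpha> b b \<gamma> else 0)"
    unfolding harm_sum_def by (rule Sum_any.cong)
  then show ?thesis by (simp only: Sum_any.delta)
qed

lemma harm_sum_eq_iff:
  "harm_sum \<alpha> c = harm_sum \<alpha> d \<longleftrightarrow> (\<forall>b. \<alpha> \<noteq> 0 \<or> b \<ge> 0 \<longrightarrow> c b = d b)"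
proof
  assume eq: "harm_sum \<alpha> c = harm_sum \<alpha> d"
  show "\<forall>b. \<alpha> \<noteq> 0 \<or> b \<ge> 0 \<longrightarrow> c b = d b"
  proof (intro allI impI)
    fix b :: int
    assume "\<alpha> \<noteq> 0 \<or> b \<ge> 0"
    then obtain \<gamma> where "harm_log \<alpha> b b \<gamma> \<noteq> (0 :: 'a)" using harm_log_nonzero by blast
    moreover have "c b * harm_log \<alpha> b b \<gamma> = d b * harm_log \<alpha> b b \<gamma>"
      using eq by (metis harm_sum_eq)
    ultimately show "c b = d b" by simp
  qed
next
  assume "\<forall>b. \<alpha> \<noteq> 0 \<or> b \<ge> 0 \<longrightarrow> c b = d b"
  then have cd: "c b = d b \<or> \<alpha> = 0 \<and> b < 0" for b
    by (meson not_less)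
  then have "c b * harm_log \<alpha> b b \<gamma> = d b * harm_log \<alpha> b b \<gamma>" for b \<gamma>
  proof (cases "c b = d b")
    case False
    with cd[of b] have "\<alpha> = 0" "b < 0" by simp_all
    then show ?thesis by (simp add: harm_log_zero)
  qed simp
  then show "harm_sum \<alpha> c = harm_sum \<alpha> d"
    by (simp add: fun_eq_iff harm_sum_eq)
qed

theorem harm_coeff_harm_sum:
  assumes "\<And>b. b > N \<Longrightarrow> c b = 0"
  shows "harm_coeff \<alpha> (harm_sum \<alpha> c) = (\<lambda>b. if \<alpha> = 0 \<and> b < 0 then 0 else c b)"
  unfolding harm_coeff_def
proof (rule the_equality)
  let ?d = "\<lambda>b. if \<alpha> = 0 \<and> b < 0 then 0 else c b"
  have "harm_sum \<alpha> c = harm_sum \<alpha> ?d" unfolding harm_sum_eq_iff by simp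
  moreover have "\<forall>b>N. ?d b = 0" using assms by simp
  ultimately show "harm_sum \<alpha> c = harm_sum \<alpha> ?d \<and> (\<exists>N. \<forall>b>N. ?d b = 0) \<and> (\<alpha> = 0 \<longrightarrow> (\<forall>b<0. ?d b = 0))"
    by (intro conjI exI[of _ N]) simp_all
  show "d = ?d" if "harm_sum \<alpha> c = harm_sum \<alpha> d \<and> (\<exists>N. \<forall>b>N. d b = 0) \<and>
      (\<alpha> = 0 \<longrightarrow> (\<forall>b<0. d b = 0))" for d
  proof
    fix b
    show "d b = ?d b"
    proof (cases "\<alpha> = 0 \<and> b < 0")
      case True
      then show ?thesis using that by simp
    next
      case False
      then have "c b = d b" using that unfolding harm_sum_eq_iff by (meson not_less)
      then show ?thesis using False by auto
    qed
  qed
qed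


subsection \<open>The operators on harmonic logarithms\<close>

lemma harm_log_eq_harm_sum: "harm_log \<alpha> a = harm_sum \<alpha> (\<lambda>b. if b = a then 1 else 0)"
  by (auto simp: fun_eq_iff harm_sum_eq harm_log_other)

lemma harm_coeff_harm_log:
  assumes "\<alpha> \<noteq> 0 \<or> a \<ge> 0"
  shows "harm_coeff \<alpha> (harm_log \<alpha> a) = (\<lambda>b. if b = a then 1 else 0)"
  unfolding harm_log_eq_harm_sum using assms
  by (subst harm_coeff_harm_sum[of a]) (auto simp: fun_eq_iff)

theorem artinian_act_harm_log:
  assumes "\<alpha> \<noteq> 0 \<or> a \<ge> 0"
  shows "artinian_act (fls_X_intpow b) \<alpha> (harm_log \<alpha> a) =
    log_scale (roman_fact a / roman_fact (a - b)) (harm_log \<alpha> (a - b) :: 'k::field_char_0 log_series)"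
proof -
  have "fls_nth (fls_X_intpow b) i * harm_coeff \<alpha> (harm_log \<alpha> a) (n + i) *
       (roman_fact (n + i) / roman_fact n) =
      (if i = b then (if n = a - b then roman_fact a / roman_fact (a - b) else 0) else 0 :: 'k)" for n i
    by (auto simp: harm_coeff_harm_log[OF assms])
  then show ?thesis
    by (auto simp: artinian_act_def fun_eq_iff harm_sum_eq log_scale_def harm_log_other)
qed

theorem roman_shift_harm_log:
  assumes "\<alpha> \<noteq> 0 \<or> a \<ge> 0"
  shows "roman_shift \<alpha> (harm_log \<alpha> a) =
    (if a = - 1 then (\<lambda>b \<gamma>. 0) else harm_log \<alpha> (a + 1) :: 'k::field_char_0 log_series)"
  unfolding roman_shift_def harm_coeff_harm_log[OF assms]
  by (auto simp: fun_eq_iff harm_sum_eq harm_log_other)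

lemma roman_fact_rec: "roman_fact (a + 1) = roman_num (a + 1) * (roman_fact a :: 'k::field_char_0)"
proof -
  consider "a \<ge> 0" | "a = - 1" | "a < - 1" by linarith
  then show ?thesis
  proof cases
    case 1
    then obtain n where "a = int n" by (metis nonneg_int_cases)
    moreover have "nat (int n + 1) = Suc n" by simp
    ultimately show ?thesis by (simp add: roman_fact_def roman_num_def algebra_simps)
  next
    case 2
    then show ?thesis by (simp add: roman_fact_def roman_num_def)
  next
    case 3
    define n where "n = nat (- a - 2)"
    have a: "a = - int n - 2" using 3 by (simp add: n_def)
    have "nat (- a - 1) = Suc n" "nat (- (a + 1) - 1) = n" "\<not> a \<ge> 0" "\<not> a + 1 \<ge> 0" "a + 1 \<noteq> 0"
      using a by auto
    moreover have "(of_int (a + 1) :: 'k) = - of_nat (Suc n)" by (simp add: a)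
    moreover have "(fact (Suc n) :: 'k) = of_nat (Suc n) * fact n" by (rule fact_Suc)
    ultimately have "roman_fact (a + 1) = ((- 1) ^ n / fact n :: 'k)"
      "roman_fact a = (- ((- 1) ^ n) / (of_nat (Suc n) * fact n) :: 'k)"
      "roman_num (a + 1) = (- of_nat (Suc n) :: 'k)"
      unfolding roman_fact_def roman_num_def by (simp_all only: if_False power_Suc mult_minus1)
    moreover have "(of_nat (Suc n) :: 'k) \<noteq> 0" by (rule of_nat_neq_0)
    ultimately show ?thesis by (simp del: of_nat_Suc)
  qed
qed

lemma roman_fact_nonzero: "roman_fact a \<noteq> (0 :: 'k::field_char_0)"
  by (simp add: roman_fact_def)

theorem artinian_act_fls_X:
  assumes "p \<in> log_space \<alpha>"
  shows "artinian_act fls_X \<alpha> p = log_deriv (p :: 'k::field_char_0 log_series)"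
proof -
  obtain c N where p: "p = harm_sum \<alpha> c" and N: "\<And>b. b > N \<Longrightarrow> c b = 0"
    using assms unfolding log_space_def by blast
  have sc: "p (a + 1) = (\<lambda>\<gamma>. c (a + 1) * harm_log \<alpha> (a + 1) (a + 1) \<gamma>)" for a
    by (simp add: p harm_sum_eq fun_eq_iff)
  obtain m where m: "log_bounded (Poly_Mapping.lookup \<alpha> 0) m (log_monom \<alpha> :: _ \<Rightarrow> 'k)"
    by (rule log_monom_bounded)
  have lin: "log_euler (\<lambda>\<gamma>. d * harm_log \<alpha> a a \<gamma>) \<gamma> = d * log_euler (harm_log \<alpha> a a) \<gamma>"
    for d :: 'k and a \<gamma>
  proof -
    have "log_bounded (Poly_Mapping.lookup \<alpha> 0) m (\<lambda>\<gamma>. d * harm_log \<alpha> a a \<gamma>)"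
      using log_bounded_harm_log[OF m, of a] unfolding log_bounded_def by auto
    then show ?thesis
      by (simp only: log_euler_bounded_eq[OF log_bounded_harm_log[OF m]] log_euler_bounded_eq
          sum_distrib_left mult.left_commute)
  qed
  have L: "log_deriv p a \<gamma> = c (a + 1) * (roman_num (a + 1) * harm_log \<alpha> a a \<gamma>)" for a \<gamma>
  proof -
    have "log_deriv p a \<gamma> = c (a + 1) * log_deriv (harm_log \<alpha> (a + 1)) a \<gamma>"
      unfolding log_deriv_def sc lin by (simp add: algebra_simps)
    then show ?thesis unfolding log_deriv_harm_log by (simp add: log_scale_def)
  qed
  have "fls_nth fls_X b * harm_coeff \<alpha> p (n + b) * (roman_fact (n + b) / roman_fact n) =
      (if b = 1 then harm_coeff \<alpha> p (n + 1) * roman_num (n + 1) else 0 :: 'k)" for n b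
    by (auto simp: roman_fact_rec roman_fact_nonzero)
  then have R: "artinian_act fls_X \<alpha> p a \<gamma> =
      harm_coeff \<alpha> p (a + 1) * roman_num (a + 1) * harm_log \<alpha> a a \<gamma>" for a \<gamma>
    by (simp add: artinian_act_def harm_sum_eq)
  have "harm_coeff \<alpha> p = (\<lambda>b. if \<alpha> = 0 \<and> b < 0 then 0 else c b)"
    unfolding p by (rule harm_coeff_harm_sum[of N]) (rule N)
  then show ?thesis
    by (auto simp: fun_eq_iff L R harm_log_zero)
qed

end

theory Submission
  imports Defs
begin

unbundle fps_syntax

text \<open>
  Encode the series with harmonic coefficients \<open>c\<^sub>n\<close> as the formal Laurent series in \<open>X\<close> whose
  coefficient of \<open>X\<^sup>-\<^sup>n\<close> is \<open>\<lfloor>n\<rceil>! c\<^sub>n\<close>. Then \<open>g(D)\<close> acts as multiplication by \<open>g(X)\<close>, and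
  the Roman shift as \<open>G \<mapsto> - X d/dX (X\<^sup>-\<^sup>1 G)\<close>. If \<open>G\<^sub>a\<close> encodes the associated sequence of \<open>f\<close>, then
  \<open>f G\<^sub>a = \<lfloor>a\<rceil> G\<^sub>a\<^sub>-\<^sub>1\<close> gives \<open>G\<^sub>a = \<lfloor>a\<rceil>! f\<^sup>-\<^sup>a G\<^sub>0\<close>, and the augmentation conditions
  \<open>[X\<^sup>0] f\<^sup>-\<^sup>a G\<^sub>0 = \<delta>\<^sub>a\<^sub>0\<close> force \<open>G\<^sub>0 = X f' / f\<close>, because \<open>f\<^sup>-\<^sup>a\<^sup>-\<^sup>1 f'\<close> is an exact derivative
  unless \<open>a = 0\<close>. Hence \<open>G\<^sub>a = \<lfloor>a\<rceil>! X f\<^sup>-\<^sup>a\<^sup>-\<^sup>1 f'\<close>; dividing by \<open>f'\<close> and shifting differentiates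
  \<open>f\<^sup>-\<^sup>a\<^sup>-\<^sup>1\<close>, which yields \<open>(a + 1) \<lfloor>a\<rceil>! X f\<^sup>-\<^sup>a\<^sup>-\<^sup>2 f'\<close>.
\<close>

section \<open>Derivatives and residues of integer powers of Laurent series\<close>

lemma fls_deriv_power_int:
  fixes f :: "'k::field fls"
  assumes "f \<noteq> 0"
  shows "fls_deriv (f powi n) = of_int n * f powi (n - 1) * fls_deriv f"
proof (cases "n \<ge> 0")
  case True
  then obtain m where m: "n = int m" by (metis nonneg_int_cases)
  show ?thesis
  proof (cases m)
    case (Suc l)
    then have "f powi (n - 1) = f ^ (m - 1)" unfolding m by (simp flip: power_int_of_nat)
    then show ?thesis by (simp add: m fls_deriv_power)
  qed (simp add: m)
next
  case False
  then obtain m where n: "n = - int (Suc m)"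
    by (metis int_cases negD linorder_not_le)
  have "f powi n = inverse (f ^ Suc m)"
    unfolding n by (simp only: power_int_minus power_int_of_nat)
  moreover have "f powi (n - 1) = inverse (f ^ Suc (Suc m))"
  proof -
    have "n - 1 = - int (Suc (Suc m))" by (simp add: n)
    then show ?thesis by (simp only: power_int_minus power_int_of_nat)
  qed
  moreover have "(of_int n :: 'k fls) = - of_nat (Suc m)" by (simp add: n)
  moreover have "fls_deriv (inverse (f ^ Suc m)) =
      - (of_nat (Suc m) * f ^ m * fls_deriv f) / (f ^ Suc m)\<^sup>2"
    by (simp only: fls_inverse_deriv' fls_deriv_power diff_Suc_1)
  moreover have "\<dots> = - of_nat (Suc m) * inverse (f ^ Suc (Suc m)) * fls_deriv f"
    using assms by (simp add: field_simps power2_eq_square)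
  ultimately show ?thesis by simp
qed

text \<open>For \<open>n \<noteq> -1\<close> the product is the derivative of
  \<open>f powi (n + 1)\<close> divided by \<open>n + 1\<close>, and derivatives have no residue.
  For \<open>n = -1\<close> it is the logarithmic derivative, whose residue is the order of
  \<open>f\<close>.\<close>

lemma fls_residue_power_int_times_deriv:
  fixes f :: "'k::field_char_0 fls"
  assumes "f \<noteq> 0"
  shows "(f powi n * fls_deriv f) $$ (-1) = (if n = -1 then of_int (fls_subdegree f) else 0)"
proof (cases "n = -1")
  case True
  then show ?thesis
    using fls_residue_deriv_times_inverse_eq_subdegree(2)[of f] by (simp add: power_int_minus)
next
  case False
  have "of_int (n + 1) * (f powi n * fls_deriv f) = fls_deriv (f powi (n + 1))"
    by (simp add: fls_deriv_power_int[OF assms] mult.assoc del: of_int_add)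
  then have "(of_int (n + 1) * (f powi n * fls_deriv f)) $$ (-1) = 0"
    by (simp only: fls_deriv_residue)
  then have "of_int (n + 1) * (f powi n * fls_deriv f) $$ (-1) = 0"
    by (simp only: fls_of_int fls_mult_const_nth)
  moreover have "(of_int (n + 1) :: 'k) \<noteq> 0"
    using False by (simp add: add_eq_0_iff2 del: of_int_add)
  ultimately show ?thesis using False by simp
qed

lemma delta_operator_subdegree:
  assumes "delta_operator f"
  shows "f \<noteq> 0" and "fls_subdegree f = 1" and "fls_subdegree (fls_deriv f) = 0"
    and "fls_deriv f \<noteq> 0"
proof -
  show f: "f \<noteq> 0" using assms unfolding delta_operator_def by auto
  show s: "fls_subdegree f = 1"
    using assms unfolding delta_operator_def by (intro fls_subdegree_eqI) auto
  show "fls_subdegree (fls_deriv f) = 0"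
    using assms s unfolding delta_operator_def by (subst fls_deriv_subdegree') auto
  show "fls_deriv f \<noteq> 0"
  proof
    assume "fls_deriv f = 0"
    then have "fls_deriv f $$ 0 = 0" by simp
    then show False using assms unfolding delta_operator_def by simp
  qed
qed

section \<open>Logarithmic series encoded as Laurent series\<close>

definition harm_fls :: "log_index \<Rightarrow> 'k::field_char_0 fls \<Rightarrow> 'k log_series" where
  "harm_fls \<alpha> G = harm_sum \<alpha> (\<lambda>n. G $$ (- n) / roman_fact n)"

lemma harm_sum_eq_harm_fls:
  fixes c :: "int \<Rightarrow> 'k::field_char_0"
  assumes "\<And>b. b > N \<Longrightarrow> c b = 0"
  shows "harm_sum \<alpha> c = harm_fls \<alpha> (Abs_fls (\<lambda>m. c (- m) * roman_fact (- m)))"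
proof -
  have "Abs_fls (\<lambda>m. c (- m) * roman_fact (- m)) $$ m = c (- m) * roman_fact (- m)" for m
    using assms by (intro nth_Abs_fls_lower_bound[of "- N"]) auto
  then show ?thesis by (simp add: harm_fls_def roman_fact_nonzero)
qed

text \<open>For \<alpha> = 0 this fails: coefficients at positive powers of X sit on harmonic
  logarithms that vanish.\<close>

lemma harm_fls_inject: "harm_fls \<alpha> G = harm_fls \<alpha> H \<longleftrightarrow> G = H" if "\<alpha> \<noteq> 0"
proof
  assume "harm_fls \<alpha> G = harm_fls \<alpha> H"
  then have "G $$ (- b) / roman_fact b = H $$ (- b) / roman_fact b" for b
    using that unfolding harm_fls_def harm_sum_eq_iff by blast
  then have "G $$ (- b) = H $$ (- b)" for b by (simp add: roman_fact_nonzero)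
  then have "G $$ b = H $$ b" for b by (metis minus_minus)
  then show "G = H" by (rule fls_eqI)
qed simp

lemma harm_coeff_harm_fls:
  "harm_coeff \<alpha> (harm_fls \<alpha> G) =
     (\<lambda>n. if \<alpha> = 0 \<and> n < 0 then 0 else G $$ (- n) / roman_fact n)"
  unfolding harm_fls_def
  by (rule harm_coeff_harm_sum[of "- fls_subdegree G"]) simp

lemma augmentation_harm_fls: "augmentation \<alpha> (harm_fls \<alpha> G) = G $$ 0"
  by (simp add: augmentation_def harm_coeff_harm_fls roman_fact_def)

lemma log_scale_harm_fls: "log_scale c (harm_fls \<alpha> G) = harm_fls \<alpha> (fls_const c * G)"
  by (simp add: log_scale_def harm_fls_def harm_sum_eq fun_eq_iff)

lemma fls_times_nth_Sum_any:
  fixes g h :: "'a::semiring_0 fls"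
  shows "Sum_any (\<lambda>b. g $$ b * h $$ (n - b)) = (g * h) $$ n"
proof -
  have "Sum_any (\<lambda>b. g $$ b * h $$ (n - b)) =
      (\<Sum>b = fls_subdegree g..n - fls_subdegree h. g $$ b * h $$ (n - b))"
  proof (rule Sum_any.expand_superset)
    show "{b. g $$ b * h $$ (n - b) \<noteq> 0} \<subseteq> {fls_subdegree g..n - fls_subdegree h}"
    proof clarify
      fix b
      assume nz: "g $$ b * h $$ (n - b) \<noteq> 0"
      then have "g $$ b \<noteq> 0" "h $$ (n - b) \<noteq> 0"
        by auto
      then have "fls_subdegree g \<le> b" "fls_subdegree h \<le> n - b"
        by (auto intro: fls_subdegree_leI)
      then show "b \<in> {fls_subdegree g..n - fls_subdegree h}" by simp
    qed
  qed simp
  then show ?thesis by (simp add: fls_times_nth(2))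
qed

text \<open>The Roman factorials cancel and leave a Cauchy product. For \<alpha> = 0 a negative
  power of \<open>D\<close> would reach coefficients normalised to 0, whence the condition on
  \<open>g\<close>.\<close>

lemma artinian_act_harm_fls:
  assumes "\<alpha> \<noteq> 0 \<or> fls_subdegree g \<ge> 0"
  shows "artinian_act g \<alpha> (harm_fls \<alpha> G) = harm_fls \<alpha> (g * G)"
  unfolding artinian_act_def harm_coeff_harm_fls unfolding harm_fls_def harm_sum_eq_iff
proof (intro allI impI)
  fix n :: int
  assume n: "\<alpha> \<noteq> 0 \<or> n \<ge> 0"
  let ?G = "fls_const (1 / roman_fact n) * G"
  have term_eq: "g $$ b * (if \<alpha> = 0 \<and> n + b < 0 then 0 else G $$ (- (n + b)) / roman_fact (n + b)) *
      (roman_fact (n + b) / roman_fact n) = g $$ b * ?G $$ (- n - b)" for b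
  proof (cases "\<alpha> = 0 \<and> n + b < 0")
    case True
    then have "g $$ b = 0" using assms n by auto
    then show ?thesis by simp
  next
    case False
    then show ?thesis by (auto simp: roman_fact_nonzero)
  qed
  show "Sum_any (\<lambda>b. g $$ b *
      (if \<alpha> = 0 \<and> n + b < 0 then 0 else G $$ (- (n + b)) / roman_fact (n + b)) *
      (roman_fact (n + b) / roman_fact n)) = (g * G) $$ (- n) / roman_fact n"
    unfolding term_eq fls_times_nth_Sum_any by (simp add: mult.left_commute[of g])
qed

text \<open>Differentiation produces the factor \<open>n\<close>. It kills the term at
  \<open>n = 0\<close>, as the shift does, and elsewhere it is the Roman number relating the
  factorials of \<open>n\<close> and \<open>n - 1\<close>.\<close>

lemma roman_shift_harm_fls:
  "roman_shift \<alpha> (harm_fls \<alpha> G) = harm_fls \<alpha> (- (fls_X * fls_deriv (fls_X_inv * G)))"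
  unfolding roman_shift_def harm_coeff_harm_fls unfolding harm_fls_def harm_sum_eq_iff
proof (intro allI impI)
  fix n :: int
  assume n: "\<alpha> \<noteq> 0 \<or> n \<ge> 0"
  have "roman_fact n = roman_num n * (roman_fact (n - 1) :: 'a)"
    using roman_fact_rec[of "n - 1"] by simp
  moreover have "(- (fls_X * fls_deriv (fls_X_inv * G))) $$ (- n) = of_int n * G $$ (1 - n)"
    by (simp add: fls_X_times_conv_shift fls_X_inv_times_conv_shift)
  ultimately show "(if n = 0 then 0
      else if \<alpha> = 0 \<and> n - 1 < 0 then 0 else G $$ (- (n - 1)) / roman_fact (n - 1)) =
      (- (fls_X * fls_deriv (fls_X_inv * G))) $$ (- n) / roman_fact n"
    using n by (auto simp: roman_num_def)
qed

section \<open>Closed form of the associated sequence\<close>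

lemma associated_fls_eq:
  fixes f :: "'k::field_char_0 fls"
  assumes f: "delta_operator f"
    and rec: "\<And>a. f * G a = fls_const (roman_num a) * G (a - 1)"
    and aug: "\<And>a. G a $$ 0 = (if a = 0 then 1 else 0)"
  shows "G a = fls_const (roman_fact a) * (fls_X * (f powi (- a - 1) * fls_deriv f))"
proof -
  note f0 = delta_operator_subdegree[OF f]
  \<comment> \<open>Removing the Roman factorial reduces the recursion to multiplication by
    \<open>f\<close>.\<close>
  define H where "H a = fls_const (1 / roman_fact a) * G a" for a
  have G: "G a = fls_const (roman_fact a) * H a" for a
    by (simp add: H_def fls_const_mult_const mult.assoc[symmetric] roman_fact_nonzero)
  have step: "f * H (a + 1) = H a" for a
  proof -
    have "f * H (a + 1) = fls_const (1 / roman_fact (a + 1)) * (f * G (a + 1))"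
      by (simp add: H_def mult_ac)
    also have "\<dots> = fls_const (1 / roman_fact (a + 1) * roman_num (a + 1)) * G a"
      by (simp add: rec fls_const_mult_const mult.assoc[symmetric])
    also have "1 / roman_fact (a + 1) * roman_num (a + 1) = (1 / roman_fact a :: 'k)"
      unfolding roman_fact_rec by (simp add: roman_num_def add_eq_0_iff2 del: of_int_add)
    finally show ?thesis by (simp add: H_def)
  qed
  have pow: "f powi a * H a = H 0" for a
  proof (induction a rule: int_induct[where k = 0])
    case base
    then show ?case by simp
  next
    case (step1 i)
    have "f powi (i + 1) * H (i + 1) = f powi i * (f * H (i + 1))"
      using f0(1) by (simp add: power_int_add)
    then show ?case using step1 by (simp only: step)
  next
    case (step2 i)
    have "f powi (i - 1) * H (i - 1) = f powi (i - 1) * f * H i"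
      using step[of "i - 1"] by (simp add: mult.assoc)
    also have "f powi (i - 1) * f = f powi i"
      using f0(1) by (simp add: power_int_minus_mult)
    finally show ?case using step2 by simp
  qed
  have H: "H a = f powi (- a) * H 0" for a
    using f0(1) by (simp add: pow[of a, symmetric] power_int_minus)
  define E where "E = H 0 - fls_X * (f powi (-1) * fls_deriv f)"
  have pow_diff: "f powi (- a - 1) = f powi (- a) * f powi (-1)" for a
    using f0(1) power_int_add[of f "- a" "-1"] by simp
  have E_coeff: "(f powi (- a) * E) $$ 0 = 0" for a
  proof -
    have "f powi (- a) * E = H a - fls_X * (f powi (- a - 1) * fls_deriv f)"
      unfolding E_def H[of a] pow_diff by (simp add: right_diff_distrib mult_ac)
    moreover have "H a $$ 0 = (if a = 0 then 1 else 0)"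
      using aug[of a] by (simp add: H_def roman_fact_def)
    \<comment> \<open>The factor X moves the residue to the constant coefficient, and the exponent
      \<open>- a - 1\<close> is -1 exactly when \<open>a = 0\<close>.\<close>
    ultimately show ?thesis
      using fls_residue_power_int_times_deriv[OF f0(1), of "- a - 1"] f0(2)
      by (simp add: fls_X_times_conv_shift)
  qed
  have "E = 0"
  proof (rule ccontr)
    \<comment> \<open>As \<open>f\<close> has order 1, a suitable power of it moves the leading
      coefficient of \<open>E\<close> to the constant position, where \<open>E_coeff\<close> forces
      it to be 0.\<close>
    assume "E \<noteq> 0"
    moreover have "f powi (- fls_subdegree E) \<noteq> 0" using f0(1) by simp
    ultimately have "fls_subdegree (f powi (- fls_subdegree E) * E) = 0"
        and "f powi (- fls_subdegree E) * E \<noteq> 0"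
      using f0(2) by simp_all
    then show False using E_coeff nth_fls_subdegree_nonzero by metis
  qed
  then have "H 0 = fls_X * (f powi (-1) * fls_deriv f)" by (simp add: E_def)
  then have "H a = fls_X * (f powi (- a - 1) * fls_deriv f)"
    unfolding H[of a] pow_diff by (simp add: mult_ac)
  then show ?thesis by (simp add: G)
qed

lemma associated_graded_sequence_eq_harm_fls:
  fixes f :: "'k::field_char_0 fls"
  assumes f: "delta_operator f" and p: "associated_graded_sequence f p"
  shows "p a \<alpha> =
    harm_fls \<alpha> (fls_const (roman_fact a) * (fls_X * (f powi (- a - 1) * fls_deriv f)))"
proof -
  \<comment> \<open>At index (1) the encoding is injective. Since \<open>G\<close> does not depend
    on \<alpha>, what is derived there holds for every index, including (0).\<close>
  let ?one = "Poly_Mapping.single 0 1 :: log_index"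
  have one: "?one \<noteq> 0" by simp
  obtain c where c: "\<And>a b. b > a \<Longrightarrow> c a b = 0" "\<And>a \<alpha>. p a \<alpha> = harm_sum \<alpha> (c a)"
    using p unfolding associated_graded_sequence_def graded_sequence_def by metis
  define G where "G a = Abs_fls (\<lambda>m. c a (- m) * roman_fact (- m))" for a
  have pG: "p a \<alpha> = harm_fls \<alpha> (G a)" for a \<alpha>
    unfolding c(2) G_def by (rule harm_sum_eq_harm_fls[of a]) (rule c(1))
  have rec: "f * G a = fls_const (roman_num a) * G (a - 1)" for a
  proof -
    have "artinian_act f ?one (p a ?one) = log_scale (roman_num a) (p (a - 1) ?one)"
      using p unfolding associated_graded_sequence_def by blast
    then show ?thesis
      unfolding pG artinian_act_harm_fls[OF disjI1[OF one]] log_scale_harm_fls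
        harm_fls_inject[OF one] .
  qed
  have aug: "G a $$ 0 = (if a = 0 then 1 else 0)" for a
    using p unfolding associated_graded_sequence_def pG augmentation_harm_fls by simp
  show ?thesis unfolding pG associated_fls_eq[of f G, OF f rec aug] ..
qed

theorem mainTheorem10:
  fixes f :: "'k::field_char_0 fls"
    and p :: "int \<Rightarrow> log_index \<Rightarrow> 'k log_series"
    and a :: int and \<alpha> :: log_index
  assumes "delta_operator f"
    and "associated_graded_sequence f p"
    and "a \<noteq> -1"
  shows "p (a + 1) \<alpha> = roman_shift \<alpha> (artinian_act (inverse (fls_deriv f)) \<alpha> (p a \<alpha>))"
proof -
  note f0 = delta_operator_subdegree[OF assms(1)]
  note p_eq = associated_graded_sequence_eq_harm_fls[OF assms(1,2)]
  let ?r = "fls_const (roman_fact a) :: 'k fls"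
  \<comment> \<open>Without negative powers, the inverse acts by multiplication at index (0)
    too.\<close>
  have "fls_subdegree (inverse (fls_deriv f)) = 0" using f0(3) by simp
  then have "artinian_act (inverse (fls_deriv f)) \<alpha> (p a \<alpha>) =
      harm_fls \<alpha> (inverse (fls_deriv f) * (?r * (fls_X * (f powi (- a - 1) * fls_deriv f))))"
    unfolding p_eq by (intro artinian_act_harm_fls) simp
  also have "inverse (fls_deriv f) * (?r * (fls_X * (f powi (- a - 1) * fls_deriv f))) =
      fls_X * (?r * f powi (- a - 1))"
    using f0(4) by (simp add: field_simps)
  finally have "roman_shift \<alpha> (artinian_act (inverse (fls_deriv f)) \<alpha> (p a \<alpha>)) =
      harm_fls \<alpha> (- (fls_X * fls_deriv (fls_X_inv * (fls_X * (?r * f powi (- a - 1))))))"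
    by (simp only: roman_shift_harm_fls)
  also have "fls_X_inv * (fls_X * (?r * f powi (- a - 1))) = ?r * f powi (- a - 1)"
    by (simp add: fls_X_times_conv_shift fls_X_inv_times_conv_shift)
  also have "fls_deriv (?r * f powi (- a - 1)) =
      ?r * (of_int (- a - 1) * f powi (- a - 2) * fls_deriv f)"
  proof -
    have "- a - 1 - 1 = - a - 2" by simp
    then show ?thesis
      by (simp only: fls_deriv_mult_const_left fls_deriv_power_int[OF f0(1)])
  qed
  also have "- (fls_X * (?r * (of_int (- a - 1) * f powi (- a - 2) * fls_deriv f))) =
      (of_int (a + 1) * ?r) * (fls_X * (f powi (- (a + 1) - 1) * fls_deriv f))"
  proof -
    have "- (fls_X * (?r * (of_int (- a - 1) * P * fls_deriv f))) =
        (of_int (a + 1) * ?r) * (fls_X * (P * fls_deriv f))" for P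
      by (simp add: algebra_simps)
    moreover have "- (a + 1) - 1 = - a - 2" by simp
    ultimately show ?thesis by (simp only:)
  qed
  \<comment> \<open>Here \<open>a \<noteq> -1\<close> enters: the Roman number of 0 is 1, whereas
    differentiation gives 0.\<close>
  also have "of_int (a + 1) * ?r = fls_const (roman_fact (a + 1))"
    unfolding roman_fact_rec using assms(3)
    by (simp add: roman_num_def fls_of_int fls_const_mult_const add_eq_0_iff2 del: of_int_add)
  finally show ?thesis by (simp only: p_eq)
qed

end
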